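(* Let $2\le k\le n-1$. For every $c\in\mathbb{R}$ there exists $\lambda\in\Gamma_{k-1}(n)$ such that $$0<\sigma_{k-1;1}(\lambda)\le\sigma_{k-1;2}(\lambda)\le\dots\le\sigma_{k-1;n}(\lambda),$$ and $\psi(y)=\frac12\sum_{i=1}^n\lambda_iy_i^2$ is a $(k-1)$-convex solution of the $k$-Hessian equation $S_k[\psi]=c$. Moreover, the linearized operator of $S_k[u]$ at $\psi$, $$\mathcal{L}_\psi=\sum_{i=1}^n\sigma_{k-1;i}(\lambda)\partial_i^2,$$ is uniformly elliptic.
   Context: For $\lambda\in\mathbb{R}^n$, $\sigma_j(\lambda)$ is the $j$-th elementary symmetric polynomial, $\sigma_0=1$, and $\sigma_{j;i}(\lambda)=\partial\sigma_{j+1}(\lambda)/\partial\lambda_i$, i.e. $\sigma_j$ evaluated with $\lambda_i$ replaced by $0$. $\Gamma_j(n)=\{\lambda\in\mathbb{R}^n:\sigma_i(\lambda)>0,\ 1\le i\le j\}$. For $u\in C^2$, $S_k[u]=\sigma_k$ of the eigenvalues of $D^2u$; $u$ is $j$-convex if these eigenvalues lie in $\Gamma_j(n)$ at every point. $\mathcal{L}_\psi$ is uniformly elliptic if all its coefficients $\sigma_{k-1;i}(\lambda)$ are positive. *)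

theory Defs
  imports "HOL-Analysis.Analysis" "HOL-Computational_Algebra.Polynomial"
begin

section \<open>Elementary symmetric polynomials\<close>

definition esym :: "nat \<Rightarrow> real^'n \<Rightarrow> real" where
  "esym j l = (\<Sum>S | S \<subseteq> (UNIV :: 'n set) \<and> card S = j. \<Prod>i\<in>S. l $ i)"

definition upd :: "real^'n \<Rightarrow> 'n \<Rightarrow> real \<Rightarrow> real^'n" where
  "upd l i t = (\<chi> m. if m = i then t else l $ m)"

definition esym_del :: "nat \<Rightarrow> 'n \<Rightarrow> real^'n \<Rightarrow> real" where
  "esym_del j i l = esym j (upd l i 0)"

definition Gamma_cone :: "nat \<Rightarrow> (real^'n) set" where
  "Gamma_cone j = {l. \<forall>i\<in>{1..j}. 0 < esym i l}"

lemma esym_0: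
  fixes l :: "real^'n"
  shows "esym 0 l = 1"
proof -
  have "{S. S \<subseteq> (UNIV :: 'n set) \<and> card S = 0} = {{}}" by (auto simp: card_eq_0_iff)
  then show ?thesis by (simp add: esym_def)
qed

lemma esym_upd: "esym (Suc j) (upd l i t) = esym_del (Suc j) i l + t * esym_del j i l"
proof -
  let ?P = "\<lambda>j. {S. S \<subseteq> (UNIV :: 'a set) \<and> card S = j}"
  let ?A = "{S \<in> ?P (Suc j). i \<notin> S}" and ?B = "{S \<in> ?P (Suc j). i \<in> S}"
  let ?C = "{S \<in> ?P j. i \<notin> S}"
  have split: "sum f (?P m) = sum f {S \<in> ?P m. i \<notin> S} + sum f {S \<in> ?P m. i \<in> S}"
    for f :: "'a set \<Rightarrow> real" and m
    by (subst sum.union_disjoint [symmetric]) (auto intro!: arg_cong2 [where f = sum])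
  have out: "(\<Prod>m\<in>S. upd l i s $ m) = (\<Prod>m\<in>S. l $ m)" if "i \<notin> S" for s S
    using that by (intro prod.cong) (auto simp: upd_def)
  have inn: "(\<Prod>m\<in>S. upd l i s $ m) = s * (\<Prod>m\<in>S - {i}. l $ m)" if "i \<in> S" for s S
    using that out [of "S - {i}" s] by (subst prod.remove [of S i]) (auto simp: upd_def)
  have del: "esym_del m i l = (\<Sum>S | S \<in> ?P m \<and> i \<notin> S. \<Prod>m\<in>S. l $ m)" for m
    unfolding esym_del_def esym_def
    by (subst split) (simp add: out inn cong: conj_cong)
  have "esym (Suc j) (upd l i t) = (\<Sum>S\<in>?A. \<Prod>m\<in>S. l $ m) + (\<Sum>S\<in>?B. t * (\<Prod>m\<in>S - {i}. l $ m))"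
    unfolding esym_def by (subst split) (simp add: out inn)
  also have "(\<Sum>S\<in>?B. t * (\<Prod>m\<in>S - {i}. l $ m)) = (\<Sum>S\<in>?C. t * (\<Prod>m\<in>S. l $ m))"
    by (rule sum.reindex_bij_witness [where i = "insert i" and j = "\<lambda>S. S - {i}"])
       (auto simp: card_insert_if)
  finally show ?thesis
    by (simp add: del sum_distrib_left)
qed

text \<open>The two descriptions of \<open>\<sigma>\<^sub>j\<^sub>;\<^sub>i\<close> (set the \<open>i\<close>-th entry to 0; differentiate
  \<open>\<sigma>\<^sub>j\<^sub>+\<^sub>1\<close> in the \<open>i\<close>-th entry) agree.\<close>

lemma esym_has_partial_derivative:
  "((\<lambda>t. esym (Suc j) (upd l i t)) has_real_derivative esym_del j i l) (at (l $ i))"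
  unfolding esym_upd by (auto intro!: derivative_eq_intros)

section \<open>Eigenvalues with multiplicity\<close>

definition charpoly :: "real^'n^'n \<Rightarrow> real poly" where
  "charpoly A = det (mat [:0, 1:] - (\<chi> i j. [:A $ i $ j:]))"

text \<open>A vector listing the eigenvalues of \<open>A\<close> with algebraic multiplicity. One exists iff
  the characteristic polynomial splits over the reals, hence for every symmetric \<open>A\<close>; its
  entries come in no particular order, which is harmless since it is only used through the
  symmetric functions \<open>\<sigma>\<^sub>j\<close>, see \<open>esym_eigs\<close>.\<close>

definition eigs :: "real^'n^'n \<Rightarrow> real^'n" where
  "eigs A = (SOME m. image_mset (($) m) (mset_set UNIV) = proots (charpoly A))"

lemma esym_cong_mset:
  fixes l m :: "real^'n"
  assumes "image_mset (($) l) (mset_set UNIV) = image_mset (($) m) (mset_set UNIV)"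
  shows "esym j l = esym j m"
proof -
  obtain p where p: "p permutes (UNIV :: 'n set)" "\<And>i. l $ i = m $ p i"
    using image_mset_eq_implies_permutes [OF _ assms] by auto
  have inj: "inj p" using p(1) by (rule permutes_inj)
  have inv: "p ` (inv p ` S) = S" "inv p ` (p ` S) = S" for S
    using p(1) by (simp_all add: image_comp permutes_inv_o)
  have c: "card (p ` S) = card S" "card (inv p ` S) = card S" for S
    using inj permutes_inj [OF permutes_inv [OF p(1)]]
    by (auto intro!: card_image intro: inj_on_subset)
  show ?thesis
    unfolding esym_def
    by (rule sum.reindex_bij_witness [where j = "image p" and i = "image (inv p)"])
       (auto simp: inv c p(2) prod.reindex [OF inj_on_subset [OF inj]])
qed

lemma esym_eigs:
  fixes m :: "real^'n" and A :: "real^'n^'n"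
  assumes "image_mset (($) m) (mset_set UNIV) = proots (charpoly A)"
  shows "esym j (eigs A) = esym j m"
proof (rule esym_cong_mset)
  show "image_mset (($) (eigs A)) (mset_set UNIV) = image_mset (($) m) (mset_set UNIV)"
    unfolding eigs_def assms by (rule someI [of _ m]) (rule assms)
qed

section \<open>Hessian operators\<close>

definition pd :: "'n \<Rightarrow> (real^'n \<Rightarrow> real) \<Rightarrow> real^'n \<Rightarrow> real" where
  "pd i u x = frechet_derivative u (at x) (axis i 1)"

definition C2 :: "(real^'n \<Rightarrow> real) \<Rightarrow> bool" where
  "C2 u \<longleftrightarrow> (\<forall>x. u differentiable (at x)) \<and> (\<forall>i x. pd i u differentiable (at x)) \<and>
     (\<forall>i j. continuous_on UNIV (pd i (pd j u)))"

definition hessian :: "(real^'n \<Rightarrow> real) \<Rightarrow> real^'n \<Rightarrow> real^'n^'n" where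
  "hessian u x = (\<chi> i j. pd i (pd j u) x)"

definition S_op :: "nat \<Rightarrow> (real^'n \<Rightarrow> real) \<Rightarrow> real^'n \<Rightarrow> real" where
  "S_op k u x = esym k (eigs (hessian u x))"

definition j_convex :: "nat \<Rightarrow> (real^'n \<Rightarrow> real) \<Rightarrow> bool" where
  "j_convex j u \<longleftrightarrow> C2 u \<and> (\<forall>x. eigs (hessian u x) \<in> Gamma_cone j)"

definition solves_k_hessian :: "nat \<Rightarrow> (real^'n \<Rightarrow> real) \<Rightarrow> real \<Rightarrow> bool" where
  "solves_k_hessian k u c \<longleftrightarrow> C2 u \<and> (\<forall>x. S_op k u x = c)"

text \<open>\<open>L\<close> is the linearization of \<open>F\<close> at \<open>u\<close>: \<open>L v = d/dt F[u + t v]\<close> at \<open>t = 0\<close>, pointwise,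
  for all directions \<open>v\<close> of class \<open>C\<^sup>2\<close>.\<close>

definition is_linearization ::
  "((real^'n \<Rightarrow> real) \<Rightarrow> real^'n \<Rightarrow> real) \<Rightarrow> (real^'n \<Rightarrow> real) \<Rightarrow>
   ((real^'n \<Rightarrow> real) \<Rightarrow> real^'n \<Rightarrow> real) \<Rightarrow> bool" where
  "is_linearization F u L \<longleftrightarrow> (\<forall>v. C2 v \<longrightarrow>
     (\<forall>x. ((\<lambda>t. F (\<lambda>y. u y + t * v y) x) has_real_derivative L v x) (at 0)))"

definition diag_op :: "real^'n \<Rightarrow> (real^'n \<Rightarrow> real) \<Rightarrow> real^'n \<Rightarrow> real" where
  "diag_op a v x = (\<Sum>i\<in>UNIV. a $ i * pd i (pd i v) x)"

text \<open>Uniform ellipticity of a constant-coefficient operator \<open>\<Sum>\<^sub>i a\<^sub>i \<partial>\<^sub>i\<^sup>2\<close>: all coefficients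
  are positive. They are determined by the operator (apply it to \<open>x\<^sub>i\<^sup>2\<close>).\<close>

definition uniformly_elliptic :: "((real^'n \<Rightarrow> real) \<Rightarrow> real^'n \<Rightarrow> real) \<Rightarrow> bool" where
  "uniformly_elliptic L \<longleftrightarrow> (\<exists>a. L = diag_op a \<and> (\<forall>i. 0 < a $ i))"

end

theory Submission
  imports Defs "HOL-Computational_Algebra.Fundamental_Theorem_Algebra"
begin

text \<open>Take all entries of \<open>\<lambda>\<close> equal to a large \<open>s > 0\<close> except the last one, \<open>a\<close>, which is fixed by
  \<open>\<sigma>\<^sub>k(\<lambda>) = c\<close>; this equation is affine in \<open>a\<close>. As \<open>s\<close> grows, \<open>a / s\<close> tends to
  \<open>- (n - k) / k\<close>, which exceeds the threshold \<open>- (n - k) / (k - 1)\<close> for positivity of the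
  \<open>\<sigma>\<^sub>k\<^sub>-\<^sub>1\<^sub>;\<^sub>i\<close> and of \<open>\<sigma>\<^sub>1, \<dots>, \<sigma>\<^sub>k\<^sub>-\<^sub>1\<close>, and the ordering of the \<open>\<sigma>\<^sub>k\<^sub>-\<^sub>1\<^sub>;\<^sub>i\<close> reduces to \<open>a \<le> s\<close>.

  For the linearization, the characteristic polynomial of a symmetric matrix splits over the
  reals, so \<open>\<sigma>\<^sub>k\<close> of its eigenvalues is, up to sign, a coefficient of that polynomial, which can be
  differentiated through the Leibniz formula. Hessians of \<open>C\<^sup>2\<close> functions are symmetric by
  Young's theorem, read off from the limit of second difference quotients.\<close>

section \<open>Characteristic polynomials of symmetric matrices\<close>

lemma coeff_prod_linear:
  fixes m :: "real^'n"
  assumes "k \<le> CARD('n)"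
  shows "coeff (\<Prod>i\<in>UNIV. [:- m $ i, 1:]) (CARD('n) - k) = (-1) ^ k * esym k m"
proof -
  \<comment> \<open>\<open>X\<close> collects the factors that contribute their constant term. Since
    \<open>k \<le> CARD('n)\<close>, the truncated subtraction loses nothing, and the degree
    \<open>CARD('n) - k\<close> singles out the \<open>X\<close> of cardinality
    \<open>k\<close>.\<close>
  have eq: "(\<Prod>i\<in>UNIV. [:- m $ i, 1:]) =
      (\<Sum>X\<in>Pow UNIV. monom ((-1) ^ card X * (\<Prod>i\<in>X. m $ i)) (CARD('n) - card X))"
  proof -
    have "(\<Prod>i\<in>UNIV. [:- m $ i, 1:]) = (\<Prod>i\<in>UNIV. [:- m $ i:] + monom 1 1)"
      by (simp add: monom_altdef)
    also have "\<dots> = (\<Sum>X\<in>Pow UNIV. (\<Prod>i\<in>X. [:- m $ i:]) * (\<Prod>i\<in>UNIV - X. monom 1 1))"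
      by (rule prod_add) simp
    also have "\<dots> = (\<Sum>X\<in>Pow UNIV. monom ((-1) ^ card X * (\<Prod>i\<in>X. m $ i)) (CARD('n) - card X))"
    proof (rule sum.cong)
      fix X :: "'n set"
      have "(\<Prod>i\<in>X. [:- m $ i:]) = [:\<Prod>i\<in>X. - m $ i:]"
        by (induction X rule: infinite_finite_induct) (auto simp: one_pCons mult.commute)
      then show "(\<Prod>i\<in>X. [:- m $ i:]) * (\<Prod>i\<in>UNIV - X. monom 1 1) =
          monom ((-1) ^ card X * (\<Prod>i\<in>X. m $ i)) (CARD('n) - card X)"
        by (simp add: prod_uminus monom_power smult_monom card_Diff_subset)
    qed simp
    finally show ?thesis .
  qed
  have "coeff (\<Prod>i\<in>UNIV. [:- m $ i, 1:]) (CARD('n) - k) =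
      (\<Sum>X\<in>Pow UNIV. if card X = k then (-1) ^ k * (\<Prod>i\<in>X. m $ i) else 0)"
    unfolding eq coeff_sum
  proof (rule sum.cong)
    fix X :: "'n set"
    have "card X \<le> CARD('n)" by (simp add: card_mono)
    then show "coeff (monom ((-1) ^ card X * (\<Prod>i\<in>X. m $ i)) (CARD('n) - card X)) (CARD('n) - k) =
        (if card X = k then (-1) ^ k * (\<Prod>i\<in>X. m $ i) else 0)"
      using assms by auto
  qed simp
  also have "\<dots> = (-1) ^ k * esym k m"
    unfolding esym_def sum_distrib_left by (simp add: sum.If_cases Int_def)
  finally show ?thesis .
qed

text \<open>Separating fixed points from moved ones shows which factors contain the variable; the
  degree count and the differentiation both rest on this.\<close>

lemma charpoly_leibniz:
  fixes A :: "real^'n^'n"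
  shows "charpoly A = (\<Sum>p | p permutes UNIV.
    of_int (sign p) * (\<Prod>i\<in>UNIV. if p i = i then [:- A $ i $ i, 1:] else [:- A $ i $ p i:]))"
  unfolding charpoly_def det_def
  by (intro sum.cong arg_cong2 [where f = "(*)"] prod.cong) (auto simp: mat_def)

lemma charpoly_diag:
  fixes A :: "real^'n^'n"
  assumes "\<And>i j. i \<noteq> j \<Longrightarrow> A $ i $ j = 0"
  shows "charpoly A = (\<Prod>i\<in>UNIV. [:- A $ i $ i, 1:])"
  unfolding charpoly_def using assms by (subst det_diagonal) (auto simp: mat_def)

text \<open>The identity permutation contributes a full product of monic linear factors. Every other
  permutation moves a point, so its term has smaller degree.\<close>

lemma charpoly_monic:
  fixes A :: "real^'n^'n"
  shows "degree (charpoly A) = CARD('n)" and "lead_coeff (charpoly A) = 1"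
proof -
  define T where "T p = of_int (sign p) *
    (\<Prod>i\<in>UNIV. if p i = i then [:- A $ i $ i, 1:] else [:- A $ i $ p i:])" for p :: "'n \<Rightarrow> 'n"
  define R where "R = (\<Sum>p\<in>{p. p permutes UNIV} - {id}. T p)"
  have eq: "charpoly A = (\<Prod>i\<in>UNIV. [:- A $ i $ i, 1:]) + R"
    unfolding charpoly_leibniz T_def [symmetric] R_def
    by (subst sum.remove [of _ id]) (auto simp: T_def sign_id permutes_id)
  have "degree (T p) < CARD('n)" if "p \<noteq> id" for p
  proof -
    have "degree (T p) \<le> degree (\<Prod>i\<in>UNIV. if p i = i then [:- A $ i $ i, 1:] else [:- A $ i $ p i:])"
      unfolding T_def by (rule order.trans [OF degree_mult_le]) simp
    also have "\<dots> \<le> (\<Sum>i\<in>UNIV. degree (if p i = i then [:- A $ i $ i, 1:] else [:- A $ i $ p i:]))"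
      by (rule order.trans [OF degree_prod_sum_le]) (simp_all add: o_def)
    also have "\<dots> \<le> (\<Sum>i\<in>UNIV. if p i = i then 1 else 0)"
      by (rule sum_mono) auto
    also have "\<dots> = card {i. p i = i}" by (simp add: sum.If_cases)
    also have "\<dots> < CARD('n)"
      by (rule psubset_card_mono) (use that in \<open>auto simp: fun_eq_iff\<close>)
    finally show ?thesis .
  qed
  then have R: "degree R < CARD('n)"
    unfolding R_def by (intro degree_sum_less) auto
  have P: "degree (\<Prod>i\<in>UNIV. [:- A $ i $ i, 1:]) = CARD('n)"
    by (subst degree_prod_eq_sum_degree) auto
  show d: "degree (charpoly A) = CARD('n)"
    unfolding eq using R P by (simp add: degree_add_eq_left)
  have "coeff (\<Prod>i\<in>UNIV. [:- A $ i $ i, 1:]) CARD('n) = 1"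
    using P lead_coeff_prod [of "\<lambda>i. [:- A $ i $ i, 1:]" UNIV] by simp
  then show "lead_coeff (charpoly A) = 1"
    unfolding d using R by (simp add: eq coeff_eq_0)
qed

section \<open>Real eigenvalues and splitting over the reals\<close>

lemma map_poly_of_real_mult:
  "map_poly complex_of_real (p * q) = map_poly complex_of_real p * map_poly complex_of_real q"
  by (rule poly_eqI) (simp add: coeff_map_poly coeff_mult)

lemma map_poly_of_real_add:
  "map_poly complex_of_real (p + q) = map_poly complex_of_real p + map_poly complex_of_real q"
  by (rule poly_eqI) (simp add: coeff_map_poly)

lemma poly_map_poly_of_real:
  "poly (map_poly complex_of_real p) (of_real x) = of_real (poly p x)"
  by (induction p) (auto simp: map_poly_pCons)

text \<open>Evaluation at \<open>z\<close> is a ring homomorphism, so it passes through the Leibniz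
  formula.\<close>

lemma poly_map_poly_det:
  fixes M :: "real poly^'n^'n" and z :: complex
  shows "poly (map_poly of_real (det M)) z = det (\<chi> i j. poly (map_poly of_real (M $ i $ j)) z)"
proof -
  have h: "poly (map_poly complex_of_real (p * q)) z =
      poly (map_poly of_real p) z * poly (map_poly of_real q) z"
    "poly (map_poly complex_of_real (p + q)) z =
      poly (map_poly of_real p) z + poly (map_poly of_real q) z" for p q :: "real poly"
    by (simp_all add: map_poly_of_real_mult map_poly_of_real_add)
  have s: "poly (map_poly complex_of_real (\<Sum>x\<in>S. f x)) z = (\<Sum>x\<in>S. poly (map_poly of_real (f x)) z)"
    for S and f :: "('n \<Rightarrow> 'n) \<Rightarrow> real poly"
    by (induction S rule: infinite_finite_induct) (auto simp: h)
  have p: "poly (map_poly complex_of_real (\<Prod>x\<in>S. f x)) z = (\<Prod>x\<in>S. poly (map_poly of_real (f x)) z)"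
    for S and f :: "'n \<Rightarrow> real poly"
    by (induction S rule: infinite_finite_induct) (auto simp: h)
  have i: "poly (map_poly complex_of_real (of_int n)) z = of_int n" for n
    by (simp add: of_int_poly map_poly_pCons)
  show ?thesis unfolding det_def by (simp add: s h p i)
qed

text \<open>Hermitian form argument: a root \<open>z\<close> has a complex eigenvector
  \<open>v \<noteq> 0\<close>. The number \<open>w\<close>, which is v* A v, is real by symmetry and
  equals \<open>z\<close> times the squared norm of \<open>v\<close>.\<close>

lemma charpoly_complex_root_real:
  fixes A :: "real^'n^'n" and z :: complex
  assumes sym: "transpose A = A" and root: "poly (map_poly of_real (charpoly A)) z = 0"
  shows "z \<in> \<real>"
proof -
  define M :: "complex^'n^'n" where
    "M = (\<chi> i j. (if i = j then z else 0) - of_real (A $ i $ j))"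
  have "det M = 0"
  proof -
    have "(\<chi> i j. poly (map_poly of_real ((mat [:0, 1:] - (\<chi> i j. [:A $ i $ j:])) $ i $ j)) z) = M"
      by (auto simp: vec_eq_iff M_def mat_def map_poly_pCons)
    then show ?thesis using root unfolding charpoly_def poly_map_poly_det by simp
  qed
  then have "\<not> (\<exists>B. B ** M = mat 1)"
    using invertible_det_nz [of M] invertible_left_inverse [of M] by simp
  then obtain v where v: "M *v v = 0" "v \<noteq> 0"
    unfolding matrix_left_invertible_ker by blast
  define w where "w = (\<Sum>i\<in>UNIV. \<Sum>j\<in>UNIV. of_real (A $ i $ j) * (cnj (v $ i) * v $ j))"
  have "w \<in> \<real>"
  proof -
    have "cnj w = (\<Sum>i\<in>UNIV. \<Sum>j\<in>UNIV. of_real (A $ i $ j) * (v $ i * cnj (v $ j)))"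
      by (simp add: w_def)
    also have "\<dots> = (\<Sum>j\<in>UNIV. \<Sum>i\<in>UNIV. of_real (A $ i $ j) * (v $ i * cnj (v $ j)))"
      by (rule sum.swap)
    also have "\<dots> = w"
      unfolding w_def using sym
      by (intro sum.cong) (auto simp: transpose_def vec_eq_iff mult_ac)
    finally show ?thesis by (simp add: complex_is_Real_iff complex_eq_iff)
  qed
  moreover have "w = z * of_real (\<Sum>i\<in>UNIV. (cmod (v $ i))\<^sup>2)"
  proof -
    have "(\<Sum>j\<in>UNIV. of_real (A $ i $ j) * v $ j) = z * v $ i" for i
    proof -
      have "(M *v v) $ i = z * v $ i - (\<Sum>j\<in>UNIV. of_real (A $ i $ j) * v $ j)"
        by (simp add: matrix_vector_mult_def M_def left_diff_distrib sum_subtractf if_distrib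
              [of "\<lambda>x. x * _"] cong: if_cong)
      then show ?thesis using v(1) by simp
    qed
    then have "w = (\<Sum>i\<in>UNIV. cnj (v $ i) * (z * v $ i))"
      unfolding w_def by (simp add: sum_distrib_left [symmetric] mult.left_commute)
    then show ?thesis
      by (simp add: sum_distrib_left complex_norm_square mult_ac del: of_real_power)
  qed
  moreover have "(\<Sum>i\<in>UNIV. (cmod (v $ i))\<^sup>2) \<noteq> 0"
    using v(2) by (subst sum_nonneg_eq_0_iff) (auto simp: vec_eq_iff)
  ultimately show ?thesis
    by (metis Reals_divide Reals_of_real nonzero_mult_div_cancel_right of_real_eq_0_iff)
qed

text \<open>Induction on the degree: the fundamental theorem of algebra yields a root, real by
  assumption, and the quotient by its linear factor inherits the assumption because its complex
  roots are roots of \<open>p\<close>.\<close>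

lemma prod_proots_if_complex_roots_real:
  fixes p :: "real poly"
  assumes "p \<noteq> 0" and "\<And>z. poly (map_poly complex_of_real p) z = 0 \<Longrightarrow> z \<in> \<real>"
  shows "p = smult (lead_coeff p) (\<Prod>r\<in>#proots p. [:-r, 1:])"
  using assms
proof (induction "degree p" arbitrary: p)
  case 0
  then obtain a where "p = [:a:]" by (metis degree_eq_zeroE)
  then show ?case by simp
next
  case (Suc n)
  let ?c = "map_poly complex_of_real"
  have "degree (?c p) \<noteq> 0" using Suc.hyps(2) by (simp add: degree_map_poly)
  then have "\<exists>z. poly (?c p) z = 0"
    by (intro fundamental_theorem_of_algebra) (simp add: constant_degree)
  then obtain z where "poly (?c p) z = 0" by blast
  with Suc.prems(2) obtain r where "poly (?c p) (of_real r) = 0"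
    by (metis Reals_cases)
  then have "poly p r = 0"
    by (metis of_real_eq_0_iff poly_map_poly_of_real)
  then obtain q where q: "p = [:-r, 1:] * q" by (auto simp: poly_eq_0_iff_dvd)
  with Suc.prems(1) have nz: "q \<noteq> 0" by auto
  have "?c p = ?c [:-r, 1:] * ?c q"
    unfolding q by (rule map_poly_of_real_mult)
  then have real: "z \<in> \<real>" if "poly (?c q) z = 0" for z
    using that Suc.prems(2) [of z] by simp
  have "degree p = Suc (degree q)"
    unfolding q using nz by (subst degree_mult_eq) auto
  then have "q = smult (lead_coeff q) (\<Prod>r\<in>#proots q. [:-r, 1:])"
    using Suc.hyps nz real by auto
  then have "p = smult (lead_coeff q) ([:-r, 1:] * (\<Prod>r\<in>#proots q. [:-r, 1:]))"
    using q by (metis mult_smult_right)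
  moreover have "proots p = add_mset r (proots q)"
    unfolding q by (subst proots_mult) (use nz in \<open>auto simp del: mult_pCons_left\<close>)
  moreover have "lead_coeff p = lead_coeff q"
    unfolding q by (subst lead_coeff_mult) auto
  ultimately show ?case
    by (metis image_mset_add_mset prod_mset.add_mset)
qed

text \<open>A split monic polynomial of degree \<open>CARD('n)\<close> has exactly that many roots
  with multiplicity, so they can be indexed by \<open>'n\<close>. The vector \<open>m\<close>
  witnesses the choice made in \<open>eigs\<close>.\<close>

lemma symmetric_eigs:
  fixes A :: "real^'n^'n"
  assumes "transpose A = A"
  obtains m :: "real^'n" where "image_mset (($) m) (mset_set UNIV) = proots (charpoly A)"
    and "charpoly A = (\<Prod>i\<in>UNIV. [:- m $ i, 1:])"
proof -
  have "charpoly A = smult (lead_coeff (charpoly A)) (\<Prod>r\<in>#proots (charpoly A). [:-r, 1:])"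
    by (rule prod_proots_if_complex_roots_real)
      (use charpoly_monic [of A] charpoly_complex_root_real [OF assms] in auto)
  then have eq: "charpoly A = (\<Prod>r\<in>#proots (charpoly A). [:-r, 1:])"
    using charpoly_monic(2) [of A] by simp
  have deg: "degree (\<Prod>r\<in>#R. [:-r, 1::real:]) = size R" for R
  proof (induction R)
    case (add x R)
    have "0 \<notin># image_mset (\<lambda>r. [:-r, 1::real:]) R" by auto
    then have "(\<Prod>r\<in>#R. [:-r, 1::real:]) \<noteq> 0" by (simp add: prod_mset_zero_iff)
    then show ?case using add by (simp add: degree_mult_eq del: mult_pCons_left)
  qed simp
  have "size (proots (charpoly A)) = CARD('n)"
    using deg [of "proots (charpoly A)"] charpoly_monic(1) [of A] eq by simp
  moreover obtain xs where xs: "mset xs = proots (charpoly A)" using ex_mset by blast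
  ultimately have len: "length xs = CARD('n)" by (metis size_mset)
  obtain h where h: "bij_betw h (UNIV :: 'n set) {0..<CARD('n)}"
    using ex_bij_betw_finite_nat [of "UNIV :: 'n set"] by auto
  have "image_mset (($) (\<chi> i. xs ! h i)) (mset_set UNIV) = image_mset ((!) xs) (image_mset h (mset_set UNIV))"
    by (simp add: image_mset.compositionality o_def cong: image_mset_cong)
  also have "image_mset h (mset_set UNIV) = mset_set {0..<CARD('n)}"
    using h by (simp add: bij_betw_def image_mset_mset_set)
  also have "image_mset ((!) xs) \<dots> = mset xs"
    using len by (metis map_nth mset_map mset_upt)
  also note xs
  finally have m: "image_mset (($) (\<chi> i. xs ! h i)) (mset_set UNIV) = proots (charpoly A)" .
  show ?thesis
  proof (rule that)
    show "charpoly A = (\<Prod>i\<in>UNIV. [:- (\<chi> i. xs ! h i) $ i, 1:])"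
      by (subst eq, subst m [symmetric]) (simp add: image_mset.compositionality o_def prod_unfold_prod_mset)
  qed (rule m)
qed

text \<open>This removes the choice in \<open>eigs\<close>: the right-hand side is a polynomial in
  the entries of \<open>A\<close>, so no regularity of individual eigenvalues is called for.\<close>

lemma esym_eigs_symmetric:
  fixes A :: "real^'n^'n"
  assumes "transpose A = A" and "k \<le> CARD('n)"
  shows "esym k (eigs A) = (-1) ^ k * coeff (charpoly A) (CARD('n) - k)"
proof -
  obtain m :: "real^'n" where m: "image_mset (($) m) (mset_set UNIV) = proots (charpoly A)"
    "charpoly A = (\<Prod>i\<in>UNIV. [:- m $ i, 1:])"
    using symmetric_eigs [OF assms(1)] by metis
  have "coeff (charpoly A) (CARD('n) - k) = (-1) ^ k * esym k m"
    unfolding m(2) by (rule coeff_prod_linear [OF assms(2)])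
  moreover have "(-1) ^ k * ((-1) ^ k * esym k m) = esym k m"
    by (simp flip: mult.assoc power_add)
  ultimately show ?thesis by (simp add: esym_eigs [OF m(1)])
qed

section \<open>Differentiating the characteristic polynomial\<close>

text \<open>Real polynomials carry no topology here, so differentiation of a polynomial-valued function
  is understood coefficientwise.\<close>

definition has_poly_derivative :: "(real \<Rightarrow> real poly) \<Rightarrow> real poly \<Rightarrow> real \<Rightarrow> bool" where
  "has_poly_derivative F G x \<longleftrightarrow> (\<forall>j. ((\<lambda>t. coeff (F t) j) has_real_derivative coeff G j) (at x))"

lemma has_poly_derivative_const: "has_poly_derivative (\<lambda>t. p) 0 x"
  by (simp add: has_poly_derivative_def)

lemma has_poly_derivative_pCons:
  assumes "(f has_real_derivative d) (at x)" "has_poly_derivative F G x"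
  shows "has_poly_derivative (\<lambda>t. pCons (f t) (F t)) (pCons d G) x"
  using assms by (auto simp: has_poly_derivative_def coeff_pCons split: nat.split)

lemma has_poly_derivative_sum:
  assumes "\<And>i. i \<in> I \<Longrightarrow> has_poly_derivative (F i) (G i) x"
  shows "has_poly_derivative (\<lambda>t. \<Sum>i\<in>I. F i t) (\<Sum>i\<in>I. G i) x"
  using assms by (auto simp: has_poly_derivative_def coeff_sum intro!: DERIV_sum)

lemma has_poly_derivative_mult:
  assumes "has_poly_derivative F F' x" "has_poly_derivative G G' x"
  shows "has_poly_derivative (\<lambda>t. F t * G t) (F' * G x + F x * G') x"
proof -
  have "((\<lambda>t. coeff (F t * G t) j) has_real_derivative
      (\<Sum>i\<le>j. coeff F' i * coeff (G x) (j - i) + coeff G' (j - i) * coeff (F x) i)) (at x)" for j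
    unfolding coeff_mult using assms
    by (intro DERIV_sum DERIV_mult) (auto simp: has_poly_derivative_def)
  then show ?thesis
    by (simp add: has_poly_derivative_def coeff_mult sum.distrib mult.commute [of "coeff G' _"])
qed

lemma has_poly_derivative_prod:
  assumes "finite I" and "\<And>i. i \<in> I \<Longrightarrow> has_poly_derivative (F i) (F' i) x"
  shows "has_poly_derivative (\<lambda>t. \<Prod>i\<in>I. F i t) (\<Sum>i\<in>I. F' i * (\<Prod>j\<in>I - {i}. F j x)) x"
  using assms
proof (induction I)
  case empty
  then show ?case using has_poly_derivative_const [of 1] by simp
next
  case (insert a I)
  have "(\<Prod>j\<in>insert a I - {i}. F j x) = F a x * (\<Prod>j\<in>I - {i}. F j x)" if "i \<in> I" for i
  proof -
    have "insert a I - {i} = insert a (I - {i})" using insert.hyps that by auto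
    then show ?thesis using insert.hyps by simp
  qed
  then have "(\<Sum>i\<in>insert a I. F' i * (\<Prod>j\<in>insert a I - {i}. F j x)) =
      F' a * (\<Prod>j\<in>I. F j x) + F a x * (\<Sum>i\<in>I. F' i * (\<Prod>j\<in>I - {i}. F j x))"
    using insert.hyps by (simp add: sum_distrib_left mult_ac)
  then show ?case
    using has_poly_derivative_mult [OF insert.prems [of a] insert.IH] insert by simp
qed

text \<open>Setting the \<open>i\<close>-th entry to 0 turns its factor into the variable itself, so
  the remaining product has the coefficients of the full one shifted by one degree.\<close>

lemma coeff_prod_linear_remove:
  fixes l :: "real^'n"
  assumes "1 \<le> k" and "k \<le> CARD('n)"
  shows "coeff (\<Prod>j\<in>UNIV - {i}. [:- l $ j, 1:]) (CARD('n) - k) = (-1) ^ (k - 1) * esym_del (k - 1) i l"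
proof -
  have "(\<Prod>j\<in>UNIV. [:- upd l i 0 $ j, 1:]) = [:0, 1:] * (\<Prod>j\<in>UNIV - {i}. [:- l $ j, 1:])"
    by (subst prod.remove [of _ i]) (auto simp: upd_def intro!: prod.cong)
  moreover have "CARD('n) - (k - 1) = Suc (CARD('n) - k)" using assms by simp
  ultimately have "coeff (\<Prod>j\<in>UNIV - {i}. [:- l $ j, 1:]) (CARD('n) - k) =
      coeff (\<Prod>j\<in>UNIV. [:- upd l i 0 $ j, 1:]) (CARD('n) - (k - 1))"
    by simp
  also have "\<dots> = (-1) ^ (k - 1) * esym (k - 1) (upd l i 0)"
    by (rule coeff_prod_linear) (use assms in simp)
  finally show ?thesis by (simp add: esym_del_def)
qed

text \<open>Jacobi's formula for the determinant: when \<open>A\<close> is diagonal, the adjugate of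
  the characteristic matrix is diagonal too, its entries being the products over the other indices.
  Hence only the diagonal of \<open>B\<close> enters.\<close>

lemma charpoly_has_poly_derivative:
  fixes A B :: "real^'n^'n"
  assumes diag: "\<And>i j. i \<noteq> j \<Longrightarrow> A $ i $ j = 0"
  shows "has_poly_derivative (\<lambda>t. charpoly (A + t *\<^sub>R B))
    (- (\<Sum>i\<in>UNIV. smult (B $ i $ i) (\<Prod>j\<in>UNIV - {i}. [:- A $ j $ j, 1:]))) 0"
proof -
  define F where "F p i t = (if p i = i then [:- (A + t *\<^sub>R B) $ i $ i, 1:]
    else [:- (A + t *\<^sub>R B) $ i $ p i:])" for p and i :: 'n and t
  \<comment> \<open>The product rule makes \<open>D p\<close> the derivative at 0 of the Leibniz
    term of \<open>p\<close>; fixed and moved points alike give the factor derivative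
    \<open>- B $ i $ p i\<close>.\<close>
  define D where "D p = of_int (sign p) * (\<Sum>i\<in>UNIV. [:- B $ i $ p i:] * (\<Prod>j\<in>UNIV - {i}. F p j 0))"
    for p
  have F: "has_poly_derivative (F p i) [:- B $ i $ p i:] 0" for p i
    unfolding F_def
    by (cases "p i = i")
      (auto intro!: has_poly_derivative_pCons has_poly_derivative_const derivative_eq_intros)
  have "has_poly_derivative (\<lambda>t. charpoly (A + t *\<^sub>R B)) (\<Sum>p | p permutes UNIV. D p) 0"
    unfolding charpoly_leibniz F_def [symmetric]
  proof (rule has_poly_derivative_sum)
    fix p :: "'n \<Rightarrow> 'n"
    have "has_poly_derivative (\<lambda>t. of_int (sign p) * (\<Prod>i\<in>UNIV. F p i t))
        (0 * (\<Prod>i\<in>UNIV. F p i 0) + of_int (sign p) * (\<Sum>i\<in>UNIV. [:- B $ i $ p i:] * (\<Prod>j\<in>UNIV - {i}. F p j 0))) 0"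
      by (intro has_poly_derivative_mult has_poly_derivative_const has_poly_derivative_prod F) simp
    then show "has_poly_derivative (\<lambda>t. of_int (sign p) * (\<Prod>i\<in>UNIV. F p i t)) (D p) 0"
      by (simp add: D_def)
  qed
  \<comment> \<open>a permutation other than the identity moves at least two points, so its Leibniz term
    vanishes to second order\<close>
  moreover have "D p = 0" if p: "p permutes UNIV" "p \<noteq> id" for p
  proof -
    have "(\<Prod>j\<in>UNIV - {i}. F p j 0) = 0" for i
    proof -
      obtain a where a: "p a \<noteq> a" using p(2) by (auto simp: fun_eq_iff)
      then have "p (p a) \<noteq> p a" using permutes_inj [OF p(1)] by (auto dest: injD)
      with a obtain j where j: "j \<noteq> i" "p j \<noteq> j" by metis
      then have "F p j 0 = 0" using diag [of j "p j"] by (simp add: F_def)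
      with j show ?thesis by (intro prod_zero) auto
    qed
    then show ?thesis unfolding D_def by (simp only: mult_zero_right sum.neutral_const)
  qed
  then have "(\<Sum>p | p permutes UNIV. D p) = D id"
    by (subst sum.remove [of _ id]) (auto simp: permutes_id intro!: sum.neutral)
  moreover have "D id = - (\<Sum>i\<in>UNIV. smult (B $ i $ i) (\<Prod>j\<in>UNIV - {i}. [:- A $ j $ j, 1:]))"
    by (simp add: D_def F_def sign_id sum_negf)
  ultimately show ?thesis by simp
qed

lemma esym_eigs_has_derivative_at_diag:
  fixes A B :: "real^'n^'n"
  assumes diag: "\<And>i j. i \<noteq> j \<Longrightarrow> A $ i $ j = 0" and sym: "transpose B = B"
    and k: "1 \<le> k" "k \<le> CARD('n)"
  shows "((\<lambda>t. esym k (eigs (A + t *\<^sub>R B))) has_real_derivative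
    (\<Sum>i\<in>UNIV. esym_del (k - 1) i (\<chi> i. A $ i $ i) * B $ i $ i)) (at 0)"
proof -
  let ?l = "\<chi> i. A $ i $ i" and ?P = "\<lambda>i. \<Prod>j\<in>UNIV - {i}. [:- A $ j $ j, 1:]"
  have "transpose A = A"
    using diag by (auto simp: transpose_def vec_eq_iff) metis
  then have "transpose (A + t *\<^sub>R B) = A + t *\<^sub>R B" for t
    using sym by (auto simp: transpose_def vec_eq_iff)
  then have eq: "esym k (eigs (A + t *\<^sub>R B)) = (-1) ^ k * coeff (charpoly (A + t *\<^sub>R B)) (CARD('n) - k)" for t
    using k by (intro esym_eigs_symmetric) auto
  have P: "coeff (?P i) (CARD('n) - k) = (-1) ^ (k - 1) * esym_del (k - 1) i ?l" for i
    using coeff_prod_linear_remove [OF k, of ?l i] by simp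
  \<comment> \<open>This sign cancels the minus in the derivative of the characteristic
    polynomial.\<close>
  have sgn: "(-1) ^ k * ((-1) ^ (k - 1) * y) = - y" for y :: real
    using k(1) by (cases k) (simp_all flip: mult.assoc power_add)
  have "((\<lambda>t. coeff (charpoly (A + t *\<^sub>R B)) (CARD('n) - k)) has_real_derivative
      coeff (- (\<Sum>i\<in>UNIV. smult (B $ i $ i) (?P i))) (CARD('n) - k)) (at 0)"
    using charpoly_has_poly_derivative [OF diag, of B] unfolding has_poly_derivative_def by blast
  then have "((\<lambda>t. (-1) ^ k * coeff (charpoly (A + t *\<^sub>R B)) (CARD('n) - k)) has_real_derivative
      (-1) ^ k * coeff (- (\<Sum>i\<in>UNIV. smult (B $ i $ i) (?P i))) (CARD('n) - k)) (at 0)"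
    by (rule DERIV_cmult)
  moreover have "(-1) ^ k * coeff (- (\<Sum>i\<in>UNIV. smult (B $ i $ i) (?P i))) (CARD('n) - k) =
      (\<Sum>i\<in>UNIV. esym_del (k - 1) i ?l * B $ i $ i)"
  proof -
    have "coeff (- (\<Sum>i\<in>UNIV. smult (B $ i $ i) (?P i))) (CARD('n) - k) =
        (-1) ^ (k - 1) * (- (\<Sum>i\<in>UNIV. esym_del (k - 1) i ?l * B $ i $ i))"
      by (simp add: coeff_sum P sum_distrib_left mult_ac)
    then show ?thesis using sgn by simp
  qed
  ultimately show ?thesis unfolding eq by simp
qed

section \<open>Hessians and the linearization\<close>

lemma pd_eqI:
  assumes "(u has_derivative u') (at x)"
  shows "pd i u x = u' (axis i 1)"
  using frechet_derivative_at [OF assms] by (simp add: pd_def)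

text \<open>Restriction to a coordinate line makes the one-variable mean value theorem
  applicable.\<close>

lemma pd_line_derivative:
  assumes "u differentiable (at (z + s *\<^sub>R axis i 1))"
  shows "((\<lambda>s. u (z + s *\<^sub>R axis i 1)) has_real_derivative pd i u (z + s *\<^sub>R axis i 1)) (at s)"
proof -
  have u: "(u has_derivative frechet_derivative u (at (z + s *\<^sub>R axis i 1))) (at (z + s *\<^sub>R axis i 1))"
    using assms frechet_derivative_works by blast
  have "((\<lambda>s. z + s *\<^sub>R axis i 1) has_derivative (\<lambda>h. h *\<^sub>R axis i 1)) (at s)"
    by (auto intro!: derivative_eq_intros)
  from has_derivative_compose [OF this u]
  have "((\<lambda>s. u (z + s *\<^sub>R axis i 1)) has_derivative
      (\<lambda>h. frechet_derivative u (at (z + s *\<^sub>R axis i 1)) (h *\<^sub>R axis i 1))) (at s)" .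
  moreover have "frechet_derivative u (at (z + s *\<^sub>R axis i 1)) (h *\<^sub>R axis i 1) =
      pd i u (z + s *\<^sub>R axis i 1) * h" for h
    by (simp add: pd_def linear_cmul [OF linear_frechet_derivative [OF assms]])
  ultimately show ?thesis by (simp add: has_field_derivative_def)
qed

text \<open>The mean value theorem in direction \<open>i\<close> reduces the second difference to an
  increment of \<open>pd i u\<close>, which its differentiability at \<open>x\<close> evaluates in
  direction \<open>j\<close>.\<close>

lemma second_difference_limit:
  fixes u :: "real^'n \<Rightarrow> real"
  assumes u: "\<And>y. u differentiable (at y)" and pdu: "pd i u differentiable (at x)"
  shows "((\<lambda>t. (u (x + t *\<^sub>R axis i 1 + t *\<^sub>R axis j 1) - u (x + t *\<^sub>R axis i 1)
      - u (x + t *\<^sub>R axis j 1) + u x) / t\<^sup>2) \<longlongrightarrow> pd j (pd i u) x) (at_right 0)"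
proof (rule tendstoI)
  fix e :: real assume "0 < e"
  let ?f = "pd i u" and ?i = "axis i 1 :: real^'n" and ?j = "axis j 1 :: real^'n"
  define f' where "f' = frechet_derivative ?f (at x)"
  have f': "(?f has_derivative f') (at x)"
    unfolding f'_def using pdu frechet_derivative_works by blast
  then have lin: "linear f'" by (rule has_derivative_linear)
  \<comment> \<open>The two points used below lie within \<open>2 * t\<close> and \<open>t\<close>
    of \<open>x\<close>, so with \<open>e / 4\<close> the total error is at most 3/4 of
    \<open>e * t\<close>.\<close>
  obtain d where d: "0 < d"
    and bound: "\<And>y. norm (y - x) < d \<Longrightarrow> \<bar>?f y - ?f x - f' (y - x)\<bar> \<le> e / 4 * norm (y - x)"
    using f' \<open>0 < e\<close> unfolding has_derivative_at_alt real_norm_def by (metis divide_pos_pos zero_less_numeral)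
  have close: "dist ((u (x + t *\<^sub>R ?i + t *\<^sub>R ?j) - u (x + t *\<^sub>R ?i) - u (x + t *\<^sub>R ?j) + u x) / t\<^sup>2)
      (pd j ?f x) < e" if t: "0 < t" "t < d / 2" for t
  proof -
    define g where "g s = u (x + t *\<^sub>R ?j + s *\<^sub>R ?i) - u (x + s *\<^sub>R ?i)" for s
    have "(g has_real_derivative ?f (x + t *\<^sub>R ?j + s *\<^sub>R ?i) - ?f (x + s *\<^sub>R ?i)) (at s)" for s
      unfolding g_def by (intro DERIV_diff pd_line_derivative u)
    from MVT2 [OF t(1) this] obtain s where s: "0 < s" "s < t"
      and gs: "g t - g 0 = (t - 0) * (?f (x + t *\<^sub>R ?j + s *\<^sub>R ?i) - ?f (x + s *\<^sub>R ?i))"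
      by blast
    have n1: "norm (t *\<^sub>R ?j + s *\<^sub>R ?i) \<le> 2 * t"
      by (rule order.trans [OF norm_triangle_ineq]) (use s t in simp)
    have n2: "norm (s *\<^sub>R ?i) \<le> t" using s by simp
    have "\<bar>?f (x + t *\<^sub>R ?j + s *\<^sub>R ?i) - ?f x - f' (t *\<^sub>R ?j + s *\<^sub>R ?i)\<bar> \<le> e / 4 * (2 * t)"
      using bound [of "x + t *\<^sub>R ?j + s *\<^sub>R ?i"] n1 t \<open>0 < e\<close>
      by (smt (verit) add.assoc add_diff_cancel_left' divide_pos_pos mult_left_mono field_sum_of_halves)
    moreover have "\<bar>?f (x + s *\<^sub>R ?i) - ?f x - f' (s *\<^sub>R ?i)\<bar> \<le> e / 4 * t"
      using bound [of "x + s *\<^sub>R ?i"] n2 t \<open>0 < e\<close>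
      by (smt (verit) add_diff_cancel_left' divide_pos_pos mult_left_mono field_sum_of_halves)
    \<comment> \<open>The unknown intermediate point \<open>s\<close> enters both linear
      approximations equally and drops out of their difference.\<close>
    moreover have "f' (t *\<^sub>R ?j + s *\<^sub>R ?i) = t * pd j ?f x + f' (s *\<^sub>R ?i)"
      by (simp add: linear_add [OF lin] linear_cmul [OF lin] pd_eqI [OF f'])
    ultimately have "\<bar>?f (x + t *\<^sub>R ?j + s *\<^sub>R ?i) - ?f (x + s *\<^sub>R ?i) - t * pd j ?f x\<bar> \<le> e / 4 * (2 * t) + e / 4 * t"
      by linarith
    also have "\<dots> < e * t" using t \<open>0 < e\<close> by simp
    finally have lt: "\<bar>?f (x + t *\<^sub>R ?j + s *\<^sub>R ?i) - ?f (x + s *\<^sub>R ?i) - t * pd j ?f x\<bar> < e * t" .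
    have "u (x + t *\<^sub>R ?i + t *\<^sub>R ?j) - u (x + t *\<^sub>R ?i) - u (x + t *\<^sub>R ?j) + u x = g t - g 0"
      by (simp add: g_def add_ac)
    moreover have "t * X / t\<^sup>2 - p = (X - t * p) / t" for X p
      using t(1) by (simp add: field_simps power2_eq_square)
    ultimately have "(u (x + t *\<^sub>R ?i + t *\<^sub>R ?j) - u (x + t *\<^sub>R ?i) - u (x + t *\<^sub>R ?j) + u x) / t\<^sup>2 - pd j ?f x =
        (?f (x + t *\<^sub>R ?j + s *\<^sub>R ?i) - ?f (x + s *\<^sub>R ?i) - t * pd j ?f x) / t"
      using gs by (simp only: diff_0_right)
    then show ?thesis
      using lt t(1) by (simp add: dist_real_def abs_divide pos_divide_less_eq)
  qed
  show "\<forall>\<^sub>F t in at_right 0. dist ((u (x + t *\<^sub>R ?i + t *\<^sub>R ?j) - u (x + t *\<^sub>R ?i)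
      - u (x + t *\<^sub>R ?j) + u x) / t\<^sup>2) (pd j ?f x) < e"
    unfolding eventually_at_right_field using d close by (intro exI [of _ "d / 2"]) auto
qed

text \<open>The second difference is symmetric in \<open>i\<close> and \<open>j\<close>, so its two
  limits agree.\<close>

lemma pd_commute:
  fixes u :: "real^'n \<Rightarrow> real"
  assumes "\<And>y. u differentiable (at y)" and "pd i u differentiable (at x)" "pd j u differentiable (at x)"
  shows "pd i (pd j u) x = pd j (pd i u) x"
proof -
  let ?D = "\<lambda>i j t. (u (x + t *\<^sub>R axis i 1 + t *\<^sub>R axis j 1) - u (x + t *\<^sub>R axis i 1)
      - u (x + t *\<^sub>R axis j 1) + u x) / t\<^sup>2"
  have "?D i j = ?D j i" by (auto simp: fun_eq_iff add_ac)
  then show ?thesis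
    using second_difference_limit [OF assms(1,2), of j] second_difference_limit [OF assms(1,3), of i]
    by (metis (lifting) tendsto_unique trivial_limit_at_right_real)
qed

lemma hessian_symmetric: "C2 u \<Longrightarrow> transpose (hessian u x) = hessian u x"
  unfolding transpose_def hessian_def C2_def by (auto simp: vec_eq_iff intro!: pd_commute)

lemma pd_add_mult:
  assumes "u differentiable (at x)" "v differentiable (at x)"
  shows "pd i (\<lambda>y. u y + t * v y) x = pd i u x + t * pd i v x"
proof -
  have "((\<lambda>y. u y + t * v y) has_derivative
      (\<lambda>h. frechet_derivative u (at x) h + t * frechet_derivative v (at x) h)) (at x)"
    using assms unfolding frechet_derivative_works by (auto intro!: derivative_eq_intros)
  from pd_eqI [OF this] show ?thesis by (simp add: pd_def)
qed

lemma hessian_add_mult: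
  assumes "C2 u" "C2 v"
  shows "hessian (\<lambda>y. u y + t * v y) x = hessian u x + t *\<^sub>R hessian v x"
proof -
  have "pd j (\<lambda>y. u y + t * v y) = (\<lambda>y. pd j u y + t * pd j v y)" for j
    using assms by (auto simp: C2_def pd_add_mult)
  then show ?thesis
    using assms by (auto simp: hessian_def vec_eq_iff C2_def pd_add_mult)
qed

section \<open>The quadratic potential and its linearized operator\<close>

definition quadratic_potential :: "real^'n \<Rightarrow> real^'n \<Rightarrow> real" where
  "quadratic_potential l y = 1 / 2 * (\<Sum>i\<in>UNIV. l $ i * (y $ i)\<^sup>2)"

lemma vec_nth_has_derivative: "((\<lambda>y. y $ i) has_derivative (\<lambda>h. h $ i)) (at (x :: real^'n))"
  by (rule bounded_linear_imp_has_derivative [OF bounded_linear_vec_nth])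

lemma quadratic_potential_has_derivative:
  "(quadratic_potential l has_derivative (\<lambda>h. \<Sum>i\<in>UNIV. l $ i * x $ i * h $ i)) (at x)"
  unfolding quadratic_potential_def [abs_def]
  by (auto intro!: derivative_eq_intros vec_nth_has_derivative simp: sum_distrib_left mult_ac)

lemma pd_quadratic_potential: "pd i (quadratic_potential l) = (\<lambda>y. l $ i * y $ i)"
  using pd_eqI [OF quadratic_potential_has_derivative] by (auto simp: axis_def if_distrib cong: if_cong)

lemma scaled_component_has_derivative:
  "((\<lambda>y. l $ i * y $ i) has_derivative (\<lambda>h. l $ i * h $ i)) (at (x :: real^'n))"
  by (auto intro!: derivative_eq_intros vec_nth_has_derivative)

lemma pd_pd_quadratic_potential:
  fixes l :: "real^'n"
  shows "pd j (pd i (quadratic_potential l)) = (\<lambda>y. if i = j then l $ i else 0)"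
proof
  fix x :: "real^'n"
  have "pd j (\<lambda>y. l $ i * y $ i) x = l $ i * axis j 1 $ i"
    by (rule pd_eqI) (rule scaled_component_has_derivative)
  then show "pd j (pd i (quadratic_potential l)) x = (if i = j then l $ i else 0)"
    by (simp add: pd_quadratic_potential axis_def)
qed

lemma C2_quadratic_potential: "C2 (quadratic_potential l)"
  unfolding C2_def pd_pd_quadratic_potential unfolding pd_quadratic_potential
  by (auto intro: differentiableI vec_nth_has_derivative quadratic_potential_has_derivative scaled_component_has_derivative)

lemma hessian_quadratic_potential:
  "hessian (quadratic_potential l) x = (\<chi> i j. if i = j then l $ i else 0)"
  by (auto simp: hessian_def pd_pd_quadratic_potential vec_eq_iff)

text \<open>The entries of \<open>l\<close> are the roots of the characteristic polynomial; the
  chosen \<open>eigs\<close> may only reorder them.\<close>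

lemma esym_eigs_diag:
  fixes l :: "real^'n"
  shows "esym k (eigs (\<chi> i j. if i = j then l $ i else 0)) = esym k l"
proof (rule esym_eigs)
  have "charpoly (\<chi> i j. if i = j then l $ i else 0) = (\<Prod>i\<in>UNIV. [:- l $ i, 1:])"
    by (subst charpoly_diag) auto
  then show "image_mset (($) l) (mset_set UNIV) = proots (charpoly (\<chi> i j. if i = j then l $ i else 0))"
    by (simp add: proots_prod sum_unfold_sum_mset)
qed

lemma j_convex_quadratic_potential: "l \<in> Gamma_cone j \<Longrightarrow> j_convex j (quadratic_potential l)"
  by (simp add: j_convex_def C2_quadratic_potential hessian_quadratic_potential Gamma_cone_def
      esym_eigs_diag)

lemma solves_k_hessian_quadratic_potential:
  "solves_k_hessian k (quadratic_potential l) (esym k l)"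
  by (simp add: solves_k_hessian_def C2_quadratic_potential S_op_def hessian_quadratic_potential
      esym_eigs_diag)

text \<open>The Hessian of the perturbed potential is affine in \<open>t\<close>, with diagonal
  value at 0 and a slope that is symmetric by Young's theorem.\<close>

lemma is_linearization_quadratic_potential:
  fixes l :: "real^'n"
  assumes "1 \<le> k" "k \<le> CARD('n)"
  shows "is_linearization (S_op k) (quadratic_potential l) (diag_op (\<chi> i. esym_del (k - 1) i l))"
  unfolding is_linearization_def
proof (intro allI impI)
  fix v :: "real^'n \<Rightarrow> real" and x assume v: "C2 v"
  let ?A = "(\<chi> i j. if i = j then l $ i else 0) :: real^'n^'n"
  have "S_op k (\<lambda>y. quadratic_potential l y + t * v y) x = esym k (eigs (?A + t *\<^sub>R hessian v x))" for t
    unfolding S_op_def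
    by (simp add: hessian_add_mult [OF C2_quadratic_potential v] hessian_quadratic_potential)
  moreover have "((\<lambda>t. esym k (eigs (?A + t *\<^sub>R hessian v x))) has_real_derivative
      (\<Sum>i\<in>UNIV. esym_del (k - 1) i (\<chi> i. ?A $ i $ i) * hessian v x $ i $ i)) (at 0)"
    by (rule esym_eigs_has_derivative_at_diag) (use assms hessian_symmetric [OF v] in auto)
  moreover have "(\<chi> i. ?A $ i $ i) = l" by (simp add: vec_eq_iff)
  ultimately show "((\<lambda>t. S_op k (\<lambda>y. quadratic_potential l y + t * v y) x) has_real_derivative
      diag_op (\<chi> i. esym_del (k - 1) i l) v x) (at 0)"
    by (simp add: diag_op_def hessian_def)
qed

section \<open>Vectors with one exceptional entry\<close>

lemma esym_two_valued_0:
  fixes A :: "'n::finite set"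
  shows "esym j ((\<chi> i. if i \<in> A then s else 0) :: real^'n) = real (card A choose j) * s ^ j"
proof -
  have "esym j ((\<chi> i. if i \<in> A then s else 0) :: real^'n) =
      (\<Sum>S | S \<subseteq> UNIV \<and> card S = j. if S \<subseteq> A then s ^ j else 0)"
    unfolding esym_def
  proof (rule sum.cong)
    fix S :: "'n set" assume "S \<in> {S. S \<subseteq> UNIV \<and> card S = j}"
    then have "card S = j" by simp
    moreover have "(\<Prod>i\<in>S. (\<chi> i. if i \<in> A then s else 0) $ i) = (\<Prod>i\<in>S. s)" if "S \<subseteq> A"
      using that by (intro prod.cong) auto
    ultimately show "(\<Prod>i\<in>S. (\<chi> i. if i \<in> A then s else 0) $ i) = (if S \<subseteq> A then s ^ j else 0)"
      by auto
  qed simp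
  also have "\<dots> = (\<Sum>S | S \<subseteq> A \<and> card S = j. s ^ j)"
    by (rule sum.mono_neutral_cong_right) auto
  finally show ?thesis by (simp add: n_subsets)
qed

context
  fixes p :: "'n::finite" and s a :: real and l :: "real^'n"
  defines "l \<equiv> \<chi> i. if i = p then a else s"
begin

lemma esym_del_spike: "esym_del j p l = real ((CARD('n) - 1) choose j) * s ^ j"
proof -
  have "upd l p 0 = (\<chi> i. if i \<in> UNIV - {p} then s else 0)"
    by (auto simp: upd_def l_def vec_eq_iff)
  then show ?thesis
    unfolding esym_del_def by (simp only: esym_two_valued_0 card_Diff_singleton [OF UNIV_I])
qed

text \<open>Expansion at the exceptional index \<open>p\<close>; being affine in \<open>a\<close>,
  it can be solved for \<open>a\<close>.\<close>

lemma esym_spike: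
  "esym (Suc j) l = real ((CARD('n) - 1) choose Suc j) * s ^ Suc j + a * (real ((CARD('n) - 1) choose j) * s ^ j)"
proof -
  have "l = upd l p a" by (auto simp: upd_def l_def vec_eq_iff)
  then have "esym (Suc j) l = esym (Suc j) (upd l p a)" by simp
  then show ?thesis unfolding esym_upd by (simp add: esym_del_spike)
qed

lemma esym_del_flat:
  assumes "i \<noteq> p"
  shows "esym_del (Suc j) i l =
    real ((CARD('n) - 2) choose Suc j) * s ^ Suc j + a * (real ((CARD('n) - 2) choose j) * s ^ j)"
proof -
  \<comment> \<open>Zeroing entry \<open>i\<close> leaves \<open>a\<close> at \<open>p\<close> and
    \<open>s\<close> at the other \<open>CARD('n) - 2\<close> places, so \<open>w\<close> is the
    vector to expand from at \<open>p\<close>.\<close>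
  define w :: "real^'n" where "w = (\<chi> m. if m \<in> UNIV - {i, p} then s else 0)"
  have "upd l i 0 = upd w p a"
    using assms by (auto simp: upd_def l_def w_def vec_eq_iff)
  moreover have "upd w p 0 = w" by (auto simp: upd_def w_def vec_eq_iff)
  moreover have "card (UNIV - {i, p}) = CARD('n) - 2"
    using assms by (subst card_Diff_subset) auto
  then have "esym m w = real ((CARD('n) - 2) choose m) * s ^ m" for m
    unfolding w_def esym_two_valued_0 by (rule arg_cong)
  ultimately show ?thesis
    by (simp only: esym_del_def [of _ i] esym_upd) (simp only: esym_del_def)
qed

end

section \<open>Binomial estimates and choice of parameters\<close>

lemma Suc_times_binomial_real:
  assumes "j \<le> m"
  shows "real (m choose Suc j) = (real m - real j) / real (Suc j) * real (m choose j)"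
proof -
  have "Suc j * (m choose Suc j) = (m - j) * (m choose j)"
    using binomial_absorb_comp [of m j] binomial_absorption [of j m] by simp
  then have "real (Suc j) * real (m choose Suc j) = (real m - real j) * real (m choose j)"
    using assms by (metis of_nat_diff of_nat_mult)
  then show ?thesis by (simp add: field_simps)
qed

text \<open>Dividing by the positive factor \<open>real (m choose j) * s ^ j\<close> leaves
  \<open>(m - j) / (j + 1) * s + a\<close>. The ratio decreases in \<open>j\<close>, so
  \<open>j = q\<close> is the worst case.\<close>

lemma binomial_form_pos:
  assumes "j \<le> q" "q \<le> m" "0 < s" and pos: "0 < (real m - real q) / real (Suc q) * s + a"
  shows "0 < real (m choose Suc j) * s ^ Suc j + a * (real (m choose j) * s ^ j)"
proof -
  have "(real m - real q) / real (Suc q) \<le> (real m - real j) / real (Suc j)"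
    using assms(1,2) by (intro frac_le) auto
  then have "(real m - real q) / real (Suc q) * s \<le> (real m - real j) / real (Suc j) * s"
    using \<open>0 < s\<close> by (intro mult_right_mono) auto
  then have "0 < real (m choose j) * s ^ j * ((real m - real j) / real (Suc j) * s + a)"
    using assms by (intro mult_pos_pos) (auto simp: zero_less_binomial_iff)
  also have "\<dots> = real (m choose Suc j) * s ^ Suc j + a * (real (m choose j) * s ^ j)"
    using assms by (subst Suc_times_binomial_real) (auto simp: algebra_simps)
  finally show ?thesis .
qed

lemma spike_parameters:
  fixes c :: real
  assumes "Suc (Suc q) \<le> m"
  obtains s a :: real where "0 < s" "a \<le> s" "0 < (real (m - 1) - real q) / real (Suc q) * s + a"
    and "real (m choose Suc (Suc q)) * s ^ Suc (Suc q) + a * (real (m choose Suc q) * s ^ Suc q) = c"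
proof
  define C N b where "C = real (m choose Suc q)" and "N = real (m - 1) - real q"
    and "b = real (Suc q) * real (Suc (Suc q))"
  \<comment> \<open>Since \<open>N / (q + 1) - N / (q + 2) = N / b\<close>, this choice makes the
    gap between threshold and leading part of \<open>a\<close> exactly
    \<open>N * (\<bar>c\<bar> + 1)\<close>.\<close>
  define s where "s = b * (\<bar>c\<bar> + 1)"
  \<comment> \<open>The solution of the affine equation, using that
    \<open>m choose Suc (Suc q)\<close> is \<open>N / (q + 2)\<close> times \<open>C\<close>. Its
    first summand is at most \<open>\<bar>c\<bar>\<close> in absolute value, hence smaller than the
    gap.\<close>
  define a where "a = c / (C * s ^ Suc q) - N / real (Suc (Suc q)) * s"
  have C: "1 \<le> C" unfolding C_def using assms by (simp add: Suc_leI zero_less_binomial_iff)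
  have N: "1 \<le> N" unfolding N_def using assms by simp
  have b: "1 \<le> b" unfolding b_def by (simp add: algebra_simps)
  have s1: "\<bar>c\<bar> + 1 \<le> s"
    using mult_right_mono [OF b, of "\<bar>c\<bar> + 1"] by (simp add: s_def)
  have Cs: "1 \<le> C * s ^ Suc q"
    using mult_mono [OF C one_le_power [of s "Suc q"]] s1 C by (simp del: power_Suc)
  then have small: "\<bar>c / (C * s ^ Suc q)\<bar> \<le> \<bar>c\<bar>"
    using mult_left_mono [OF Cs, of "\<bar>c\<bar>"] by (simp add: abs_divide abs_of_pos pos_divide_le_eq)
  show "0 < s" using s1 by simp
  have "0 \<le> N / real (Suc (Suc q)) * s" using N s1 by simp
  then show "a \<le> s" using small s1 unfolding a_def by linarith
  have "N / real (Suc q) * s - N / real (Suc (Suc q)) * s = N * (\<bar>c\<bar> + 1)"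
  proof -
    have "N / x * (x * y * z) - N / y * (x * y * z) = N * z * (y - x)" if "x \<noteq> 0" "y \<noteq> 0" for x y z :: real
      using that by (simp add: field_simps)
    from this [of "real (Suc q)" "real (Suc (Suc q))" "\<bar>c\<bar> + 1"] show ?thesis
      unfolding s_def b_def by simp
  qed
  moreover have "\<bar>c\<bar> + 1 \<le> N * (\<bar>c\<bar> + 1)" using mult_right_mono [OF N, of "\<bar>c\<bar> + 1"] by simp
  ultimately show "0 < (real (m - 1) - real q) / real (Suc q) * s + a"
    using small unfolding a_def N_def [symmetric] by linarith
  have "real (m choose Suc (Suc q)) = N / real (Suc (Suc q)) * C"
    unfolding C_def N_def using assms by (subst Suc_times_binomial_real) (auto simp: of_nat_diff)
  moreover have "c / X * X = c" if "1 \<le> X" for X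
    using that by simp
  from this [OF Cs] have "a * (C * s ^ Suc q) = c - N / real (Suc (Suc q)) * s * (C * s ^ Suc q)"
    unfolding a_def left_diff_distrib by simp
  ultimately show "real (m choose Suc (Suc q)) * s ^ Suc (Suc q) + a * (real (m choose Suc q) * s ^ Suc q) = c"
    unfolding C_def [symmetric] by (simp add: mult_ac)
qed

section \<open>Assembly of the solution\<close>

theorem theorem2p7:
  fixes k :: nat and c :: real
  assumes "2 \<le> k" and "k \<le> CARD('n::{finite,linorder}) - 1"
  shows "\<exists>l :: real^('n::{finite,linorder}). l \<in> Gamma_cone (k - 1) \<and>
    0 < esym_del (k - 1) (Min UNIV) l \<and>
    (\<forall>i j. i \<le> j \<longrightarrow> esym_del (k - 1) i l \<le> esym_del (k - 1) j l) \<and>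
    (let \<psi> = (\<lambda>y :: real^('n::{finite,linorder}). 1 / 2 * (\<Sum>i\<in>UNIV. l $ i * (y $ i)\<^sup>2));
         L = diag_op (\<chi> i. esym_del (k - 1) i l)
     in j_convex (k - 1) \<psi> \<and> solves_k_hessian k \<psi> c \<and>
        is_linearization (S_op k) \<psi> L \<and> uniformly_elliptic L)"
proof -
  \<comment> \<open>The exceptional entry sits at the greatest index \<open>M\<close>;
    \<open>m\<close> counts the remaining entries.\<close>
  define m M where "m = CARD('n) - 1" and "M = Max (UNIV :: 'n set)"
  obtain q where k: "k = Suc (Suc q)" using assms(1) by (metis add_2_eq_Suc le_Suc_ex)
  have qm: "Suc (Suc q) \<le> m" using assms(2) by (simp add: m_def k)
  have m2: "CARD('n) - 2 = m - 1" by (simp add: m_def)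
  obtain s a :: real where s: "0 < s" and as: "a \<le> s"
    and pos: "0 < (real (m - 1) - real q) / real (Suc q) * s + a"
    and c: "real (m choose Suc (Suc q)) * s ^ Suc (Suc q) + a * (real (m choose Suc q) * s ^ Suc q) = c"
    using spike_parameters [OF qm] by metis
  define l :: "(real, 'n) vec" where "l = (\<chi> i. if i = M then a else s)"
  have del_M: "esym_del (Suc q) M l = real (m choose Suc q) * s ^ Suc q"
    unfolding l_def m_def by (rule esym_del_spike)
  have del: "esym_del (Suc q) i l =
      real ((m - 1) choose Suc q) * s ^ Suc q + a * (real ((m - 1) choose q) * s ^ q)" if "i \<noteq> M" for i
    unfolding l_def m2 [symmetric] by (rule esym_del_flat [OF that])
  have esym_l: "esym (Suc j) l = real (m choose Suc j) * s ^ Suc j + a * (real (m choose j) * s ^ j)" for j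
    unfolding l_def m_def by (rule esym_spike)
  have del_pos: "0 < esym_del (Suc q) i l" for i
  proof (cases "i = M")
    case True
    then show ?thesis using s qm by (simp add: del_M)
  next
    case False
    have "0 < real ((m - 1) choose Suc q) * s ^ Suc q + a * (real ((m - 1) choose q) * s ^ q)"
      by (rule binomial_form_pos [OF order_refl _ s pos]) (use qm in simp)
    then show ?thesis by (simp add: del [OF False])
  qed
  have gamma: "l \<in> Gamma_cone (Suc q)"
    unfolding Gamma_cone_def
  proof (intro CollectI ballI)
    fix i assume "i \<in> {1..Suc q}"
    then obtain j where j: "i = Suc j" "j \<le> q" by (cases i) auto
    \<comment> \<open>\<open>pos\<close> is tuned to the deleted functions, where only
      \<open>m - 1\<close> entries equal \<open>s\<close>; with \<open>m\<close> of them the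
      condition is weaker.\<close>
    have "(real (m - 1) - real q) / real (Suc q) * s \<le> (real m - real q) / real (Suc q) * s"
      using s by (intro mult_right_mono divide_right_mono) auto
    with pos have "0 < (real m - real q) / real (Suc q) * s + a" by linarith
    then show "0 < esym i l"
      unfolding j(1) esym_l by (intro binomial_form_pos [OF j(2) _ s]) (use qm in simp)
  qed
  have mono: "esym_del (Suc q) i l \<le> esym_del (Suc q) j l" if "i \<le> j" for i j
  proof (cases "j = M \<and> i \<noteq> M")
    case True
    \<comment> \<open>By Pascal's rule the two deleted functions differ by
      \<open>(s - a) * real ((m - 1) choose q) * s ^ q\<close>, which is nonnegative as
      \<open>a \<le> s\<close>.\<close>
    have "m choose Suc q = ((m - 1) choose q) + ((m - 1) choose Suc q)"
      using qm by (cases m) auto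
    moreover have "a * (real ((m - 1) choose q) * s ^ q) \<le> s * (real ((m - 1) choose q) * s ^ q)"
      using as s by (intro mult_right_mono) auto
    ultimately show ?thesis using True by (simp add: del del_M algebra_simps)
  next
    case False
    \<comment> \<open>Maximality of \<open>M\<close> excludes \<open>i = M\<close> with
      \<open>j \<noteq> M\<close>; in the remaining cases both sides coincide.\<close>
    have "j \<le> M" unfolding M_def by simp
    with False that have "i = M \<longleftrightarrow> j = M" by auto
    then show ?thesis by (cases "i = M") (simp_all add: del)
  qed
  have "solves_k_hessian k (quadratic_potential l) c"
    using solves_k_hessian_quadratic_potential [of k l] by (simp only: k esym_l c)
  moreover have "is_linearization (S_op k) (quadratic_potential l) (diag_op (\<chi> i. esym_del (k - 1) i l))"
    by (rule is_linearization_quadratic_potential) (use assms in simp_all)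
  moreover have "uniformly_elliptic (diag_op (\<chi> i. esym_del (k - 1) i l))"
    unfolding uniformly_elliptic_def
    by (rule exI [of _ "\<chi> i. esym_del (k - 1) i l"]) (simp add: k del_pos)
  moreover have "j_convex (k - 1) (quadratic_potential l)"
    using j_convex_quadratic_potential [OF gamma] by (simp add: k)
  ultimately show ?thesis
    using gamma del_pos mono unfolding Let_def quadratic_potential_def [abs_def]
    by (intro exI [of _ l]) (simp add: k)
qed

end
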